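(* Let $\Theta=\left\{\Sigma_x=\begin{pmatrix} 1 & x \\ x & 1 \end{pmatrix}: x\in(-1,1)\right\}$ be the bivariate correlation model and let $\Sigma_c\in\Theta$, $c\in(-1,1)$. (i) If $c>0$, then $\log\mathrm{Vor}_\Theta(\Sigma_c)=\{S_{b,k}\in\mathcal K_\Theta(\Sigma_c): b\ge 0\}$. (ii) If $c<0$, then $\log\mathrm{Vor}_\Theta(\Sigma_c)=\{S_{b,k}\in\mathcal K_\Theta(\Sigma_c): b\le 0\}$. (iii) If $c=0$, then $\log\mathrm{Vor}_\Theta(\Sigma_c)=\{\mathrm{diag}(k,2a-k): a\ge 1/2,\ 0<k<2a\}$. In particular, the logarithmic Voronoi cells of $\Theta$ are semi-algebraic sets.
   Context: $\mathrm{PD}_2$ is the cone of real symmetric positive definite $2\times2$ matrices. A positive integer $n$ is fixed and $\ell_n(\Sigma,S)=-\frac n2\log\det\Sigma-\frac n2\mathrm{tr}(S\Sigma^{-1})$. For $\Sigma\in\Theta$, $\log\mathrm{Vor}_\Theta(\Sigma)=\{S\in\mathrm{PD}_2:\ \ell_n(\Sigma,S)\ge\ell_n(\Sigma',S)\text{ for all }\Sigma'\in\Theta\}$. The log-normal spectrahedron $\mathcal K_\Theta(\Sigma_c)$ is the set of $S\in\mathrm{PD}_2$ such that $x=c$ is a critical point of $x\mapsto\ell_n(\Sigma_x,S)$. Writing $a=(S_{11}+S_{22})/2$ and $b=S_{12}$, this condition is $c^3-bc^2-c(1-2a)-b=0$. For $c\neq0$ it is equivalent to $a=\frac{bc^2-c^3+b+c}{2c}$,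 and the elements of $\mathcal K_\Theta(\Sigma_c)$ are written $$S_{b,k}=\begin{pmatrix} k & b \\ b & 2a-k \end{pmatrix}\succ0,\qquad 0<k<2a,\quad a=\frac{bc^2-c^3+b+c}{2c}.$$ *)

theory Defs
  imports "HOL-Analysis.Analysis"
begin

definition PD2 :: "(real^2^2) set" where
  "PD2 = {S. transpose S = S \<and> (\<forall>v. v \<noteq> 0 \<longrightarrow> v \<bullet> (S *v v) > 0)}"

definition loglik :: "nat \<Rightarrow> real^2^2 \<Rightarrow> real^2^2 \<Rightarrow> real" where
  "loglik n \<Sigma> S = - (real n / 2) * ln (det \<Sigma>) - (real n / 2) * trace (S ** matrix_inv \<Sigma>)"

definition log_Vor :: "nat \<Rightarrow> (real^2^2) set \<Rightarrow> real^2^2 \<Rightarrow> (real^2^2) set" where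
  "log_Vor n \<Theta> \<Sigma> = {S \<in> PD2. \<forall>\<Sigma>'\<in>\<Theta>. loglik n \<Sigma> S \<ge> loglik n \<Sigma>' S}"

definition corr_mat :: "real \<Rightarrow> real^2^2" where
  "corr_mat x = vector [vector [1, x], vector [x, 1]]"

definition corr_model :: "(real^2^2) set" where
  "corr_model = corr_mat ` {-1<..<1}"

definition lognormal_spectrahedron :: "nat \<Rightarrow> real \<Rightarrow> (real^2^2) set" where
  "lognormal_spectrahedron n c =
     {S \<in> PD2. ((\<lambda>x. loglik n (corr_mat x) S) has_real_derivative 0) (at c)}"

text \<open>For \<open>c \<noteq> 0\<close>, the half trace of a matrix in the spectrahedron at \<open>c\<close> whose
  off-diagonal entry is \<open>b\<close>: solve \<open>c^3 - b c^2 - c (1 - 2 a) - b = 0\<close> for \<open>a\<close>.\<close>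

definition half_trace :: "real \<Rightarrow> real \<Rightarrow> real" where
  "half_trace c b = (b * c^2 - c^3 + b + c) / (2 * c)"

definition S_mat :: "real \<Rightarrow> real \<Rightarrow> real \<Rightarrow> real^2^2" where
  "S_mat c b k = vector [vector [k, b], vector [b, 2 * half_trace c b - k]]"

text \<open>Finite unions of sets cut out by finitely many polynomial equations and strict
  polynomial inequalities. On a Euclidean space \<^const>\<open>real_polynomial_function\<close> (generated
  from linear forms and constants by sums and products) describes exactly the polynomials
  in the coordinates.\<close>

definition basic_semialgebraic :: "'a::euclidean_space set \<Rightarrow> bool" where
  "basic_semialgebraic A \<longleftrightarrow>
     (\<exists>P Q. finite P \<and> finite Q \<and> (\<forall>p \<in> P \<union> Q. real_polynomial_function p) \<and>
        A = {x. (\<forall>p\<in>P. p x = 0) \<and> (\<forall>q\<in>Q. q x > 0)})"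

definition semialgebraic :: "'a::euclidean_space set \<Rightarrow> bool" where
  "semialgebraic A \<longleftrightarrow>
     (\<exists>\<F>. finite \<F> \<and> (\<forall>B\<in>\<F>. basic_semialgebraic B) \<and> A = \<Union>\<F>)"

end

theory Submission
  imports Defs
begin

text \<open>
  On the model, the log-likelihood depends on \<open>S\<close> only through its trace \<open>t\<close> and its
  off-diagonal entry \<open>b\<close>: up to the factor \<open>- n / 2\<close> it is
  \<open>profile t b x = ln (1 - x\<^sup>2) + (t - 2 b x) / (1 - x\<^sup>2)\<close>, and the matter is when \<open>c\<close> is a
  global minimiser of this function on \<open>(-1, 1)\<close>.

  Bounding the difference of the two logarithms by \<open>ln u \<ge> 1 - 1 / u\<close> makes
  \<open>profile t b x - profile t b c\<close> at least a rational function with positive denominator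
  \<open>(1 - x\<^sup>2) (1 - c\<^sup>2)\<close>. Its numerator is a polynomial of degree at most two in \<open>x\<close>
  that vanishes at \<open>c\<close>, has slope \<open>2 score t b c\<close> there, and \<open>x\<^sup>2\<close>-coefficient
  \<open>excess t b c = t - 2 b c - (1 - c\<^sup>2)\<close>. At a critical point the numerator is therefore
  \<open>excess t b c * (x - c)\<^sup>2\<close>, so a nonnegative excess suffices for global minimality
  (\<open>profile_diff_ge\<close>).

  It is also necessary (\<open>profile_minimal_iff\<close>). At a critical point
  \<open>c * excess t b c = b (1 - c\<^sup>2)\<close>, so for \<open>c \<noteq> 0\<close> the excess has the sign of \<open>b c\<close>, which is
  the sign of \<open>profile t b (- c) - profile t b c\<close>; thus the only competitor that matters is the
  reflected point \<open>- c\<close>. For \<open>c = 0\<close> criticality means \<open>b = 0\<close>, the excess is \<open>t - 1\<close>, and if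
  it is negative then the profile drops below its value at 0 nearby.

  Every logarithmic Voronoi cell is thus the set of positive definite \<open>S\<close> with zero score and
  nonnegative excess (\<open>log_Vor_corr_eq\<close>). The three explicit descriptions are
  parametrisations of this set, and its semialgebraicity can be read off.
\<close>

section \<open>Minimising the profile\<close>

definition profile :: "real \<Rightarrow> real \<Rightarrow> real \<Rightarrow> real" where
  "profile t b x = ln (1 - x\<^sup>2) + (t - 2 * b * x) / (1 - x\<^sup>2)"

definition score :: "real \<Rightarrow> real \<Rightarrow> real \<Rightarrow> real" where
  "score t b c = c^3 - b * c\<^sup>2 - c * (1 - t) - b"

definition excess :: "real \<Rightarrow> real \<Rightarrow> real \<Rightarrow> real" where
  "excess t b c = t - 2 * b * c - (1 - c\<^sup>2)"

lemma one_minus_square_pos: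
  fixes x :: real
  assumes "x \<in> {-1<..<1}"
  shows "0 < 1 - x\<^sup>2"
  using assms by (simp add: abs_square_less_1 abs_less_iff)

lemma profile_has_derivative:
  assumes "c \<in> {-1<..<1}"
  shows "(profile t b has_real_derivative 2 * score t b c / (1 - c\<^sup>2)\<^sup>2) (at c)"
proof -
  have pos: "0 < 1 - c\<^sup>2" by (rule one_minus_square_pos[OF assms])
  have "((\<lambda>x. ln (1 - x\<^sup>2) + (t - 2 * b * x) / (1 - x\<^sup>2)) has_real_derivative
      (- (2 * c)) / (1 - c\<^sup>2)
        + ((- (2 * b)) * (1 - c\<^sup>2) - (t - 2 * b * c) * (- (2 * c))) / ((1 - c\<^sup>2) * (1 - c\<^sup>2)))
      (at c)"
    using pos by (auto intro!: derivative_eq_intros)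
  moreover have "(- (2 * c)) / (1 - c\<^sup>2)
        + ((- (2 * b)) * (1 - c\<^sup>2) - (t - 2 * b * c) * (- (2 * c))) / ((1 - c\<^sup>2) * (1 - c\<^sup>2))
      = 2 * score t b c / (1 - c\<^sup>2)\<^sup>2"
  proof -
    have "(- (2 * c)) / (1 - c\<^sup>2) = (- (2 * c)) * (1 - c\<^sup>2) / ((1 - c\<^sup>2) * (1 - c\<^sup>2))"
      using pos by simp
    moreover have "(- (2 * c)) * (1 - c\<^sup>2)
        + ((- (2 * b)) * (1 - c\<^sup>2) - (t - 2 * b * c) * (- (2 * c))) = 2 * score t b c"
      unfolding score_def by (simp add: algebra_simps power2_eq_square power3_eq_cube)
    ultimately show ?thesis
      by (metis add_divide_distrib power2_eq_square)
  qed
  ultimately show ?thesis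
    unfolding profile_def[abs_def] by simp
qed

lemma profile_has_derivative_zero_iff:
  assumes "c \<in> {-1<..<1}"
  shows "(profile t b has_real_derivative 0) (at c) \<longleftrightarrow> score t b c = 0"
proof
  assume "(profile t b has_real_derivative 0) (at c)"
  then have "2 * score t b c / (1 - c\<^sup>2)\<^sup>2 = 0"
    using DERIV_unique[OF profile_has_derivative[OF assms]] by blast
  then show "score t b c = 0" using one_minus_square_pos[OF assms] by simp
next
  assume "score t b c = 0"
  then show "(profile t b has_real_derivative 0) (at c)"
    using profile_has_derivative[OF assms, of t b] by simp
qed

text \<open>
  The bound \<open>ln u \<ge> 1 - 1 / u\<close> at \<open>u = (1 - x\<^sup>2) / (1 - c\<^sup>2)\<close> is tight at \<open>x = c\<close> to first
  order, so no slope is lost there; the rest is the Taylor expansion at \<open>c\<close> of a quadratic in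
  \<open>x\<close>.
\<close>

lemma profile_diff_ge:
  assumes c: "c \<in> {-1<..<1}" and x: "x \<in> {-1<..<1}"
  shows "profile t b x - profile t b c
    \<ge> (excess t b c * (x - c)\<^sup>2 + 2 * score t b c * (x - c)) / ((1 - x\<^sup>2) * (1 - c\<^sup>2))"
proof -
  have C: "0 < 1 - c\<^sup>2" and X: "0 < 1 - x\<^sup>2"
    using c x by (blast intro: one_minus_square_pos)+
  have "ln ((1 - c\<^sup>2) / (1 - x\<^sup>2)) \<le> (1 - c\<^sup>2) / (1 - x\<^sup>2) - 1"
    using C X by (intro ln_le_minus_one) simp
  then have ln_diff: "ln (1 - x\<^sup>2) - ln (1 - c\<^sup>2) \<ge> 1 - (1 - c\<^sup>2) / (1 - x\<^sup>2)"
    using C X by (simp add: ln_div)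
  have "1 - (1 - c\<^sup>2) / (1 - x\<^sup>2) + (t - 2 * b * x) / (1 - x\<^sup>2) - (t - 2 * b * c) / (1 - c\<^sup>2)
    = ((c\<^sup>2 - x\<^sup>2) * (1 - c\<^sup>2) + (t - 2 * b * x) * (1 - c\<^sup>2) - (t - 2 * b * c) * (1 - x\<^sup>2))
        / ((1 - x\<^sup>2) * (1 - c\<^sup>2))"
    using C X by (simp add: divide_simps) (simp add: algebra_simps)
  also have "(c\<^sup>2 - x\<^sup>2) * (1 - c\<^sup>2) + (t - 2 * b * x) * (1 - c\<^sup>2) - (t - 2 * b * c) * (1 - x\<^sup>2)
    = excess t b c * (x - c)\<^sup>2 + 2 * score t b c * (x - c)"
    unfolding excess_def score_def by (simp add: algebra_simps power2_eq_square power3_eq_cube)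
  finally show ?thesis
    using ln_diff unfolding profile_def by linarith
qed

lemma excess_at_critical:
  assumes "score t b c = 0"
  shows "c * excess t b c = b * (1 - c\<^sup>2)"
  using assms unfolding score_def excess_def
  by (simp add: algebra_simps power2_eq_square power3_eq_cube)

lemma profile_reflect:
  "profile t b (- c) - profile t b c = 4 * (b * c) / (1 - c\<^sup>2)"
  unfolding profile_def by (simp add: diff_divide_distrib add_divide_distrib)

lemma excess_nonneg_iff:
  assumes "c \<in> {-1<..<1}" "c \<noteq> 0" "score t b c = 0"
  shows "0 \<le> excess t b c \<longleftrightarrow> 0 \<le> b * c"
proof -
  have "c\<^sup>2 * excess t b c = (b * c) * (1 - c\<^sup>2)"
    using excess_at_critical[OF assms(3)] by (metis mult.assoc mult.commute power2_eq_square)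
  moreover have "0 < c\<^sup>2" "0 < 1 - c\<^sup>2"
    using assms one_minus_square_pos by auto
  moreover have "0 \<le> excess t b c \<longleftrightarrow> 0 \<le> c\<^sup>2 * excess t b c"
    using \<open>0 < c\<^sup>2\<close> by (simp add: zero_le_mult_iff)
  moreover have "0 \<le> b * c \<longleftrightarrow> 0 \<le> (b * c) * (1 - c\<^sup>2)"
    using \<open>0 < 1 - c\<^sup>2\<close> by (metis mult_le_cancel_right_pos mult_zero_left)
  ultimately show ?thesis by simp
qed

text \<open>
  By \<open>ln (1 - s) \<le> - s\<close> with \<open>s = x\<^sup>2\<close>, the profile for \<open>b = 0\<close> lies below its value at 0 wherever
  \<open>0 < s < 1 - t\<close>.
\<close>

lemma profile_minimal_at_0_imp:
  assumes min: "\<And>x. x \<in> {-1<..<1} \<Longrightarrow> profile t 0 0 \<le> profile t 0 x"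
  shows "1 \<le> t"
proof (rule ccontr)
  assume "\<not> 1 \<le> t"
  then obtain s where s: "0 < s" "s < 1" "s < 1 - t"
    using dense[of 0 "min 1 (1 - t)"] by auto
  have "sqrt s \<in> {-1<..<1}"
    using s by (simp add: order_less_le_trans[OF _ real_sqrt_ge_zero])
  then have "t \<le> ln (1 - s) + t / (1 - s)"
    using min[of "sqrt s"] s by (simp add: profile_def)
  also have "\<dots> \<le> - s + t / (1 - s)"
    using ln_le_minus_one[of "1 - s"] s by simp
  finally have "t * (1 - s) \<le> - s * (1 - s) + t"
    using s by (simp add: field_simps)
  then have "s * (1 - s) \<le> s * t"
    by (simp add: algebra_simps)
  then show False using s by simp
qed

theorem profile_minimal_iff:
  assumes c: "c \<in> {-1<..<1}"
  shows "(\<forall>x\<in>{-1<..<1}. profile t b c \<le> profile t b x)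
    \<longleftrightarrow> score t b c = 0 \<and> 0 \<le> excess t b c"
proof
  assume min: "\<forall>x\<in>{-1<..<1}. profile t b c \<le> profile t b x"
  have "2 * score t b c / (1 - c\<^sup>2)\<^sup>2 = 0"
  proof (rule DERIV_local_min[OF profile_has_derivative[OF c]])
    show "0 < min (c + 1) (1 - c)" using c by simp
    show "\<forall>y. \<bar>c - y\<bar> < min (c + 1) (1 - c) \<longrightarrow> profile t b c \<le> profile t b y"
      using min by (auto simp: abs_less_iff)
  qed
  then have crit: "score t b c = 0"
    using one_minus_square_pos[OF c] by simp
  have "0 \<le> excess t b c"
  proof (cases "c = 0")
    case True
    then have "b = 0" using crit by (simp add: score_def)
    then have "1 \<le> t" using profile_minimal_at_0_imp[of t] min True by simp
    then show ?thesis using True by (simp add: excess_def)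
  next
    case False
    have "profile t b c \<le> profile t b (- c)" using min c by simp
    then have "0 \<le> 4 * (b * c) / (1 - c\<^sup>2)" using profile_reflect[of t b c] by linarith
    then have "0 \<le> b * c"
      using one_minus_square_pos[OF c] by (simp add: zero_le_divide_iff)
    then show ?thesis using excess_nonneg_iff[OF c False crit] by simp
  qed
  with crit show "score t b c = 0 \<and> 0 \<le> excess t b c" by simp
next
  assume *: "score t b c = 0 \<and> 0 \<le> excess t b c"
  show "\<forall>x\<in>{-1<..<1}. profile t b c \<le> profile t b x"
  proof
    fix x :: real assume x: "x \<in> {-1<..<1}"
    have "0 \<le> (excess t b c * (x - c)\<^sup>2 + 2 * score t b c * (x - c)) / ((1 - x\<^sup>2) * (1 - c\<^sup>2))"
      using * one_minus_square_pos[OF c] one_minus_square_pos[OF x] by simp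
    also have "\<dots> \<le> profile t b x - profile t b c"
      by (rule profile_diff_ge[OF c x])
    finally show "profile t b c \<le> profile t b x" by simp
  qed
qed

section \<open>The likelihood on the correlation model\<close>

lemma PD2_iff:
  "S \<in> PD2 \<longleftrightarrow> S$1$2 = S$2$1 \<and> 0 < S$1$1 \<and> 0 < S$1$1 * S$2$2 - (S$1$2)\<^sup>2"
proof -
  have form: "v \<bullet> (S *v v) = S$1$1 * (v$1)\<^sup>2 + (S$1$2 + S$2$1) * v$1 * v$2 + S$2$2 * (v$2)\<^sup>2"
    for v :: "real^2"
    by (simp add: inner_vec_def matrix_vector_mult_def sum_2 power2_eq_square algebra_simps)
  have sym: "transpose S = S \<longleftrightarrow> S$1$2 = S$2$1"
    by (simp only: vec_eq_iff forall_2 transpose_def vec_lambda_beta) metis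
  show ?thesis
  proof
    assume PD: "S \<in> PD2"
    then have eq: "S$1$2 = S$2$1" and pos: "\<And>v. v \<noteq> 0 \<Longrightarrow> 0 < v \<bullet> (S *v v)"
      using sym by (auto simp: PD2_def)
    have S11: "0 < S$1$1"
      using pos[of "vector [1, 0]"] unfolding form by (simp add: vec_eq_iff forall_2)
    \<comment> \<open>The vector orthogonal to the first row has value \<open>S$1$1 * det S\<close>.\<close>
    let ?v = "vector [- S$1$2, S$1$1] :: real^2"
    have "?v \<noteq> 0" using S11 by (simp add: vec_eq_iff forall_2)
    then have "0 < ?v \<bullet> (S *v ?v)" by (rule pos)
    also have "\<dots> = S$1$1 * (S$1$1 * S$2$2 - (S$1$2)\<^sup>2)"
      unfolding form eq by (simp add: power2_eq_square algebra_simps)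
    finally have "0 < S$1$1 * (S$1$1 * S$2$2 - (S$1$2)\<^sup>2)" .
    from zero_less_mult_pos[OF this S11] eq S11
    show "S$1$2 = S$2$1 \<and> 0 < S$1$1 \<and> 0 < S$1$1 * S$2$2 - (S$1$2)\<^sup>2" by (intro conjI)
  next
    assume R: "S$1$2 = S$2$1 \<and> 0 < S$1$1 \<and> 0 < S$1$1 * S$2$2 - (S$1$2)\<^sup>2"
    have "0 < v \<bullet> (S *v v)" if "v \<noteq> 0" for v
    proof -
      have square: "S$1$1 * (v \<bullet> (S *v v))
          = (S$1$1 * v$1 + S$1$2 * v$2)\<^sup>2 + (S$1$1 * S$2$2 - (S$1$2)\<^sup>2) * (v$2)\<^sup>2"
        unfolding form R[THEN conjunct1] by (simp add: power2_eq_square algebra_simps)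
      have "0 < S$1$1 * (v \<bullet> (S *v v))"
      proof (cases "v$2 = 0")
        case True
        then have "v$1 \<noteq> 0" using that by (auto simp: vec_eq_iff forall_2)
        then show ?thesis unfolding square using R True by simp
      next
        case False
        then have "0 < (S$1$1 * S$2$2 - (S$1$2)\<^sup>2) * (v$2)\<^sup>2"
          using R[THEN conjunct2] False by simp
        then show ?thesis unfolding square by (rule add_nonneg_pos[OF zero_le_power2])
      qed
      then show ?thesis using R[THEN conjunct2, THEN conjunct1] by (rule zero_less_mult_pos)
    qed
    moreover have "transpose S = S" using R by (simp only: sym)
    ultimately show "S \<in> PD2" by (simp add: PD2_def)
  qed
qed

lemma matrix_inv_eqI:
  fixes A :: "real^'n^'m" and B :: "real^'m^'n"
  assumes AB: "A ** B = mat 1" and BA: "B ** A = mat 1"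
  shows "matrix_inv A = B"
proof -
  have "A ** matrix_inv A = mat 1 \<and> matrix_inv A ** A = mat 1"
    unfolding matrix_inv_def by (rule someI[where x = B]) (simp add: assms)
  then have "B ** (A ** matrix_inv A) = B" by (simp add: matrix_mul_rid)
  then show ?thesis by (simp add: matrix_mul_assoc BA matrix_mul_lid)
qed

lemma matrix_inv_corr_mat:
  assumes "x \<in> {-1<..<1}"
  shows "matrix_inv (corr_mat x)
    = (vector [vector [1 / (1 - x\<^sup>2), - x / (1 - x\<^sup>2)],
               vector [- x / (1 - x\<^sup>2), 1 / (1 - x\<^sup>2)]] :: real^2^2)" (is "_ = ?B")
proof -
  have nz: "1 - x\<^sup>2 \<noteq> 0" using one_minus_square_pos[OF assms] by simp
  have diagonal: "1 / (1 - x\<^sup>2) - x * x / (1 - x\<^sup>2) = 1"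
    using nz by (simp add: power2_eq_square flip: diff_divide_distrib)
  have "corr_mat x ** ?B = mat 1" "?B ** corr_mat x = mat 1"
    unfolding vec_eq_iff forall_2
    using diagonal by (simp_all add: corr_mat_def matrix_matrix_mult_def mat_def sum_2)
  then show ?thesis by (rule matrix_inv_eqI)
qed

lemma loglik_corr_mat:
  assumes "x \<in> {-1<..<1}" and "S \<in> PD2"
  shows "loglik n (corr_mat x) S = - (real n / 2) * profile (S$1$1 + S$2$2) (S$1$2) x"
proof -
  have symmetric: "S$1$2 = S$2$1"
    using assms(2) unfolding PD2_iff by (rule conjunct1)
  have "det (corr_mat x) = 1 - x\<^sup>2"
    by (simp add: corr_mat_def det_2 power2_eq_square)
  moreover have "trace (S ** matrix_inv (corr_mat x))
      = (S$1$1 + S$2$2 - 2 * S$1$2 * x) / (1 - x\<^sup>2)"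
    unfolding matrix_inv_corr_mat[OF assms(1)]
    by (simp add: trace_def matrix_matrix_mult_def sum_2 flip: symmetric)
      (simp add: diff_divide_distrib add_divide_distrib)
  ultimately show ?thesis
    by (simp only: loglik_def profile_def distrib_left)
qed

lemma log_Vor_corr_eq:
  assumes "n > 0" and c: "c \<in> {-1<..<1}"
  shows "log_Vor n corr_model (corr_mat c) = {S \<in> PD2. score (S$1$1 + S$2$2) (S$1$2) c = 0
    \<and> 0 \<le> excess (S$1$1 + S$2$2) (S$1$2) c}"
proof -
  have "(\<forall>\<Sigma>\<in>corr_model. loglik n \<Sigma> S \<le> loglik n (corr_mat c) S)
      \<longleftrightarrow> (\<forall>x\<in>{-1<..<1}. profile (S$1$1 + S$2$2) (S$1$2) c
            \<le> profile (S$1$1 + S$2$2) (S$1$2) x)" if "S \<in> PD2" for S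
    using \<open>n > 0\<close> c that unfolding corr_model_def by (simp add: loglik_corr_mat)
  then show ?thesis
    unfolding log_Vor_def
    by (intro Collect_cong conj_cong refl) (simp only: profile_minimal_iff[OF c])
qed

lemma lognormal_spectrahedron_iff:
  assumes "n > 0" and c: "c \<in> {-1<..<1}"
  shows "S \<in> lognormal_spectrahedron n c
    \<longleftrightarrow> S \<in> PD2 \<and> score (S$1$1 + S$2$2) (S$1$2) c = 0"
proof (cases "S \<in> PD2")
  case True
  let ?p = "profile (S$1$1 + S$2$2) (S$1$2)"
  have "((\<lambda>x. loglik n (corr_mat x) S) has_real_derivative 0) (at c)
      \<longleftrightarrow> ((\<lambda>x. - (real n / 2) * ?p x) has_real_derivative 0) (at c)"
  proof (rule DERIV_cong_ev[OF refl _ refl])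
    show "\<forall>\<^sub>F x in nhds c. loglik n (corr_mat x) S = - (real n / 2) * ?p x"
      unfolding eventually_nhds using c True
      by (intro exI[of _ "{-1<..<1}"]) (auto simp: loglik_corr_mat)
  qed
  also have "\<dots> \<longleftrightarrow> (?p has_real_derivative 0) (at c)"
  proof
    assume "((\<lambda>x. - (real n / 2) * ?p x) has_real_derivative 0) (at c)"
    from DERIV_cmult[OF this, of "- (2 / real n)"]
    show "(?p has_real_derivative 0) (at c)" using \<open>n > 0\<close> by simp
  next
    assume "(?p has_real_derivative 0) (at c)"
    from DERIV_cmult[OF this, of "- (real n / 2)"]
    show "((\<lambda>x. - (real n / 2) * ?p x) has_real_derivative 0) (at c)" by simp
  qed
  finally show ?thesis
    using True profile_has_derivative_zero_iff[OF c] by (simp add: lognormal_spectrahedron_def)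
qed (simp add: lognormal_spectrahedron_def)

section \<open>Parametrising the cells\<close>

lemma score_zero_iff_half_trace:
  assumes "c \<noteq> 0"
  shows "score t b c = 0 \<longleftrightarrow> t = 2 * half_trace c b"
proof -
  have "2 * half_trace c b = (b * c\<^sup>2 - c^3 + b + c) / c"
    by (simp add: half_trace_def del: distrib_left_numeral right_diff_distrib_numeral)
  then have "t = 2 * half_trace c b \<longleftrightarrow> t * c = b * c\<^sup>2 - c^3 + b + c"
    using assms by (metis eq_divide_eq)
  then show ?thesis by (auto simp: score_def algebra_simps)
qed

lemma S_mat_nth [simp]:
  "S_mat c b k $ 1 $ 1 = k" "S_mat c b k $ 1 $ 2 = b"
  "S_mat c b k $ 2 $ 1 = b" "S_mat c b k $ 2 $ 2 = 2 * half_trace c b - k"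
  by (simp_all add: S_mat_def)

lemma PD2_entries_pos:
  assumes "S \<in> PD2"
  shows "0 < S$1$1" "0 < S$2$2"
proof -
  show "0 < S$1$1" using assms by (simp add: PD2_iff)
  have "(S$1$2)\<^sup>2 < S$1$1 * S$2$2" using assms unfolding PD2_iff by linarith
  then have "0 < S$1$1 * S$2$2" by (rule le_less_trans[OF zero_le_power2])
  then show "0 < S$2$2" using \<open>0 < S$1$1\<close> by (simp add: zero_less_mult_iff)
qed

lemma log_Vor_corr_nonzero:
  assumes n: "n > 0" and c: "c \<in> {-1<..<1}" "c \<noteq> 0"
  shows "log_Vor n corr_model (corr_mat c)
    = {S_mat c b k | b k. 0 < k \<and> k < 2 * half_trace c b \<and>
         S_mat c b k \<in> lognormal_spectrahedron n c \<and> 0 \<le> b * c}" (is "_ = ?R")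
proof (intro set_eqI iffI)
  fix S assume "S \<in> log_Vor n corr_model (corr_mat c)"
  then have PD: "S \<in> PD2" and crit: "score (S$1$1 + S$2$2) (S$1$2) c = 0"
    and ex: "0 \<le> excess (S$1$1 + S$2$2) (S$1$2) c"
    by (auto simp: log_Vor_corr_eq[OF n c(1)])
  have tr: "S$1$1 + S$2$2 = 2 * half_trace c (S$1$2)"
    using crit score_zero_iff_half_trace[OF c(2)] by blast
  then have S: "S = S_mat c (S$1$2) (S$1$1)"
    using PD by (simp add: vec_eq_iff forall_2 PD2_iff)
  have "S \<in> lognormal_spectrahedron n c"
    using PD crit by (simp add: lognormal_spectrahedron_iff[OF n c(1)])
  moreover have "0 < S$1$1" "S$1$1 < 2 * half_trace c (S$1$2)"
    using PD2_entries_pos[OF PD] tr by linarith+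
  moreover have "0 \<le> S$1$2 * c"
    using ex excess_nonneg_iff[OF c crit] by simp
  ultimately show "S \<in> ?R" using S
    by (intro CollectI exI[of _ "S$1$2"] exI[of _ "S$1$1"]) (simp flip: S)
next
  fix S assume "S \<in> ?R"
  then obtain b k where S: "S = S_mat c b k" and L: "S \<in> lognormal_spectrahedron n c"
    and b: "0 \<le> b * c" by auto
  have PD: "S \<in> PD2" and crit: "score (S$1$1 + S$2$2) (S$1$2) c = 0"
    using L by (auto simp: lognormal_spectrahedron_iff[OF n c(1)])
  have "0 \<le> excess (S$1$1 + S$2$2) (S$1$2) c"
    using excess_nonneg_iff[OF c crit] b S by simp
  then show "S \<in> log_Vor n corr_model (corr_mat c)"
    using PD crit by (simp add: log_Vor_corr_eq[OF n c(1)])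
qed

lemma log_Vor_corr_zero:
  assumes n: "n > 0"
  shows "log_Vor n corr_model (corr_mat 0)
    = {vector [vector [k, 0], vector [0, 2 * a - k]] | a k. a \<ge> 1 / 2 \<and> 0 < k \<and> k < 2 * a}"
    (is "_ = ?R")
proof -
  have zero: "(0::real) \<in> {-1<..<1}" by simp
  have cell: "S \<in> log_Vor n corr_model (corr_mat 0)
      \<longleftrightarrow> S \<in> PD2 \<and> S$1$2 = 0 \<and> 1 \<le> S$1$1 + S$2$2" for S
    by (simp add: log_Vor_corr_eq[OF n zero] score_def excess_def)
  show ?thesis
  proof (intro set_eqI iffI)
    fix S assume "S \<in> log_Vor n corr_model (corr_mat 0)"
    then have S: "S \<in> PD2" "S$1$2 = 0" "1 \<le> S$1$1 + S$2$2" by (auto simp: cell)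
    let ?a = "(S$1$1 + S$2$2) / 2"
    have "2 * ?a - S$1$1 = S$2$2" by (simp add: field_simps)
    then have "S = vector [vector [S$1$1, 0], vector [0, 2 * ?a - S$1$1]]"
      using S by (simp only: vec_eq_iff forall_2 PD2_iff vector_2)
    moreover have "?a \<ge> 1 / 2" "0 < S$1$1" "S$1$1 < 2 * ?a"
      using S PD2_entries_pos[of S] by auto
    ultimately show "S \<in> ?R" by blast
  next
    fix S assume "S \<in> ?R"
    then show "S \<in> log_Vor n corr_model (corr_mat 0)"
      by (auto simp: cell PD2_iff)
  qed
qed

section \<open>Semialgebraicity\<close>

lemma real_polynomial_function_entry:
  "real_polynomial_function (\<lambda>S :: real^2^2. S$i$j)"
  by (intro real_polynomial_function.intros(1)
      bounded_linear_compose[OF bounded_linear_vec_nth bounded_linear_vec_nth])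

text \<open>
  The weak inequality on the excess splits the cell into a piece with zero excess and a piece
  with positive excess.
\<close>

lemma semialgebraic_log_Vor_corr:
  assumes n: "n > 0" and c: "c \<in> {-1<..<1}"
  shows "semialgebraic (log_Vor n corr_model (corr_mat c))"
proof -
  define sym where "sym = (\<lambda>S :: real^2^2. S$1$2 - S$2$1)"
  define minor where "minor = (\<lambda>S :: real^2^2. S$1$1)"
  define dt where "dt = (\<lambda>S :: real^2^2. S$1$1 * S$2$2 - (S$1$2)\<^sup>2)"
  define sc where "sc = (\<lambda>S :: real^2^2. score (S$1$1 + S$2$2) (S$1$2) c)"
  define ex where "ex = (\<lambda>S :: real^2^2. excess (S$1$1 + S$2$2) (S$1$2) c)"
  note poly_intros = real_polynomial_function_entry real_polynomial_function_diff
    real_polynomial_function_power real_polynomial_function.intros(2-4)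
  have poly: "real_polynomial_function sym" "real_polynomial_function minor"
    "real_polynomial_function dt" "real_polynomial_function sc" "real_polynomial_function ex"
    unfolding sym_def minor_def dt_def sc_def ex_def score_def excess_def
    by (intro poly_intros)+
  have cell: "log_Vor n corr_model (corr_mat c) = {S \<in> PD2. sc S = 0 \<and> 0 \<le> ex S}"
    unfolding log_Vor_corr_eq[OF n c] sc_def ex_def by (rule refl)
  have PD: "S \<in> PD2 \<longleftrightarrow> sym S = 0 \<and> 0 < minor S \<and> 0 < dt S" for S
    unfolding PD2_iff sym_def minor_def dt_def by (simp only: right_minus_eq)
  define Z where "Z = {S. (\<forall>p\<in>{sym, sc, ex}. p S = 0) \<and> (\<forall>q\<in>{minor, dt}. q S > 0)}"
  define P where "P = {S. (\<forall>p\<in>{sym, sc}. p S = 0) \<and> (\<forall>q\<in>{minor, dt, ex}. q S > 0)}"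
  have "basic_semialgebraic Z"
    unfolding basic_semialgebraic_def
    by (rule exI[of _ "{sym, sc, ex}"], rule exI[of _ "{minor, dt}"]) (simp add: poly Z_def)
  moreover have "basic_semialgebraic P"
    unfolding basic_semialgebraic_def
    by (rule exI[of _ "{sym, sc}"], rule exI[of _ "{minor, dt, ex}"]) (simp add: poly P_def)
  moreover have "log_Vor n corr_model (corr_mat c) = \<Union>{Z, P}"
    unfolding cell by (auto simp: PD Z_def P_def)
  ultimately show ?thesis
    unfolding semialgebraic_def by (intro exI[of _ "{Z, P}"]) simp
qed

section \<open>The logarithmic Voronoi cells\<close>

theorem theorem5p5:
  fixes n :: nat and c :: real
  assumes "n > 0" and "c \<in> {-1<..<1}"
  shows "(c > 0 \<longrightarrow> log_Vor n corr_model (corr_mat c) =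
            {S_mat c b k | b k. 0 < k \<and> k < 2 * half_trace c b \<and>
               S_mat c b k \<in> lognormal_spectrahedron n c \<and> b \<ge> 0}) \<and>
         (c < 0 \<longrightarrow> log_Vor n corr_model (corr_mat c) =
            {S_mat c b k | b k. 0 < k \<and> k < 2 * half_trace c b \<and>
               S_mat c b k \<in> lognormal_spectrahedron n c \<and> b \<le> 0}) \<and>
         (c = 0 \<longrightarrow> log_Vor n corr_model (corr_mat c) =
            {vector [vector [k, 0], vector [0, 2 * a - k]] | a k.
               a \<ge> 1 / 2 \<and> 0 < k \<and> k < 2 * a}) \<and>
         (\<forall>\<Sigma>\<in>corr_model. semialgebraic (log_Vor n corr_model \<Sigma>))"
proof (intro conjI impI ballI)
  assume "c > 0"
  then show "log_Vor n corr_model (corr_mat c) =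
            {S_mat c b k | b k. 0 < k \<and> k < 2 * half_trace c b \<and>
               S_mat c b k \<in> lognormal_spectrahedron n c \<and> b \<ge> 0}"
    using log_Vor_corr_nonzero[OF assms] by (simp add: zero_le_mult_iff)
next
  assume "c < 0"
  then show "log_Vor n corr_model (corr_mat c) =
            {S_mat c b k | b k. 0 < k \<and> k < 2 * half_trace c b \<and>
               S_mat c b k \<in> lognormal_spectrahedron n c \<and> b \<le> 0}"
    using log_Vor_corr_nonzero[OF assms] by (simp add: zero_le_mult_iff)
next
  assume "c = 0"
  then show "log_Vor n corr_model (corr_mat c) =
            {vector [vector [k, 0], vector [0, 2 * a - k]] | a k.
               a \<ge> 1 / 2 \<and> 0 < k \<and> k < 2 * a}"
    using log_Vor_corr_zero[OF assms(1)] by simp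
next
  fix \<Sigma> assume "\<Sigma> \<in> corr_model"
  then show "semialgebraic (log_Vor n corr_model \<Sigma>)"
    using semialgebraic_log_Vor_corr[OF assms(1)] by (auto simp: corr_model_def)
qed

end
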